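(* Let $G$ be a finite non-abelian group. Then the proper commuting graph $\mathcal{C}^{**}(G)$ admits a total dominating set if and only if $G$ is not isomorphic to a generalized dihedral group of order $2m$ with $m$ odd. Moreover, in this case (that is, when $\mathcal{C}^{**}(G)$ admits a total dominating set), $$\gamma_t\bigl(\mathcal{C}^{**}(G)\bigr)\le 2(T-U),$$ where $T$ is the number of maximal cyclic subgroups of $G$ and $U$ is the number of maximal cyclic subgroups of $G$ completely contained in the center $Z(G)$.
   Context: For a finite group $G$, the proper commuting graph $\mathcal{C}^{**}(G)$ is the simple graph with vertex set $G\setminus Z(G)$ in which two distinct vertices $x,y$ are adjacent if and only if $xy=yx$. A total dominating set of a graph with vertex set $V$ is a subset $S\subseteq V$ such that every $v\in V$ is adjacent to some $u\in S$; the total domination number $\gamma_t$ is the minimum cardinality of a total dominating set. For a finite abelian group $A$, the generalized dihedral group $D(A)$ is the semidirect product of $A$ with a cyclic group $\langle x\rangle$ of order $2$, where $x^{-1}ax=a^{-1}$ for all $a\in A$. A maximal cyclic subgroup is a cyclic subgroup not properly contained in any other cyclic subgroup of $G$. *)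

theory Defs
  imports
    "HOL-Algebra.Elementary_Groups"
    "Graph_Theory.Graph_Theory"
begin

definition group_center :: "('a, 'b) monoid_scheme \<Rightarrow> 'a set" where
  "group_center G = {z \<in> carrier G. \<forall>g \<in> carrier G. z \<otimes>\<^bsub>G\<^esub> g = g \<otimes>\<^bsub>G\<^esub> z}"

text \<open>
  As in \<^theory>\<open>Graph_Theory.Digraph\<close>, a simple graph is a loop-free symmetric digraph; the lemma
  \<open>pair_graph_proper_commuting_graph\<close> below confirms that this is one.
\<close>

definition proper_commuting_graph :: "('a, 'b) monoid_scheme \<Rightarrow> 'a pair_pre_digraph" where
  "proper_commuting_graph G =
     \<lparr> pverts = carrier G - group_center G,
       parcs = {(x, y). x \<in> carrier G - group_center G \<and> y \<in> carrier G - group_center G \<and>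
                        x \<noteq> y \<and> x \<otimes>\<^bsub>G\<^esub> y = y \<otimes>\<^bsub>G\<^esub> x} \<rparr>"

lemma pair_graph_proper_commuting_graph:
  assumes "finite (carrier G)"
  shows "pair_graph (proper_commuting_graph G)"
proof
  show "finite (parcs (proper_commuting_graph G))"
    by (rule finite_subset[of _ "carrier G \<times> carrier G"])
      (auto simp: proper_commuting_graph_def assms)
  show "symmetric (with_proj (proper_commuting_graph G))"
    by (auto simp: proper_commuting_graph_def symmetric_def sym_def arcs_ends_def arc_to_ends_def)
qed (auto simp: proper_commuting_graph_def assms)

definition total_dominating_set :: "'a pair_pre_digraph \<Rightarrow> 'a set \<Rightarrow> bool" where
  "total_dominating_set \<Gamma> S \<longleftrightarrow>
     S \<subseteq> pverts \<Gamma> \<and> (\<forall>v \<in> pverts \<Gamma>. \<exists>u \<in> S. v \<rightarrow>\<^bsub>\<Gamma>\<^esub> u)"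

text \<open>
  Meaningful only for a graph with a finite total dominating set (the least element of an empty
  set of naturals is unspecified).
\<close>

definition total_domination_number :: "'a pair_pre_digraph \<Rightarrow> nat" where
  "total_domination_number \<Gamma> =
     (LEAST n. \<exists>S. total_dominating_set \<Gamma> S \<and> finite S \<and> card S = n)"

text \<open>The product on pairs is \<open>(a, h) (b, k) = (a \<cdot> \<phi>\<^sub>h(b), h k)\<close>.\<close>

definition semidirect_product ::
  "('a, 'm) monoid_scheme \<Rightarrow> ('h, 'n) monoid_scheme \<Rightarrow> ('h \<Rightarrow> 'a \<Rightarrow> 'a) \<Rightarrow> ('a \<times> 'h) monoid" where
  "semidirect_product A H \<phi> =
     \<lparr> carrier = carrier A \<times> carrier H,
       monoid.mult = (\<lambda>(a, h) (b, k). (a \<otimes>\<^bsub>A\<^esub> \<phi> h b, h \<otimes>\<^bsub>H\<^esub> k)),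
       one = (\<one>\<^bsub>A\<^esub>, \<one>\<^bsub>H\<^esub>) \<rparr>"

definition gen_dihedral :: "('a, 'm) monoid_scheme \<Rightarrow> ('a \<times> int) monoid" where
  "gen_dihedral A =
     semidirect_product A (integer_mod_group 2) (\<lambda>k a. if k = 0 then a else inv\<^bsub>A\<^esub> a)"

lemma carrier_gen_dihedral: "carrier (gen_dihedral A) = carrier A \<times> {0, 1}"
  by (auto simp: gen_dihedral_def semidirect_product_def integer_mod_group_def)

lemma one_gen_dihedral: "\<one>\<^bsub>gen_dihedral A\<^esub> = (\<one>\<^bsub>A\<^esub>, 0)"
  by (simp add: gen_dihedral_def semidirect_product_def integer_mod_group_def)

lemma mult_gen_dihedral:
  "(a, h) \<otimes>\<^bsub>gen_dihedral A\<^esub> (b, k) =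
     (a \<otimes>\<^bsub>A\<^esub> (if h = 0 then b else inv\<^bsub>A\<^esub> b), (h + k) mod 2)"
  by (simp add: gen_dihedral_def semidirect_product_def integer_mod_group_def)

lemma group_gen_dihedral:
  assumes "comm_group A"
  shows "group (gen_dihedral A)"
proof -
  interpret comm_group A by fact
  show ?thesis
  proof (rule groupI)
    fix p q r
    assume "p \<in> carrier (gen_dihedral A)" "q \<in> carrier (gen_dihedral A)"
      "r \<in> carrier (gen_dihedral A)"
    then show "p \<otimes>\<^bsub>gen_dihedral A\<^esub> q \<otimes>\<^bsub>gen_dihedral A\<^esub> r =
        p \<otimes>\<^bsub>gen_dihedral A\<^esub> (q \<otimes>\<^bsub>gen_dihedral A\<^esub> r)"
      by (cases p; cases q; cases r)
        (auto simp: carrier_gen_dihedral mult_gen_dihedral m_assoc inv_mult)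
  next
    fix p
    assume p: "p \<in> carrier (gen_dihedral A)"
    then obtain a k where ak: "p = (a, k)" "a \<in> carrier A" "k = 0 \<or> k = 1"
      by (cases p) (auto simp: carrier_gen_dihedral)
    then show "\<exists>q \<in> carrier (gen_dihedral A). q \<otimes>\<^bsub>gen_dihedral A\<^esub> p = \<one>\<^bsub>gen_dihedral A\<^esub>"
      by (intro bexI[of _ "(if k = 0 then inv\<^bsub>A\<^esub> a else a, k)"])
        (auto simp: carrier_gen_dihedral mult_gen_dihedral one_gen_dihedral)
  qed (auto simp: carrier_gen_dihedral mult_gen_dihedral one_gen_dihedral)
qed

text \<open>The defining relation, with \<open>(a, 0)\<close> for \<open>a\<close> and \<open>(\<one>, 1)\<close> for \<open>x\<close>.\<close>

lemma gen_dihedral_conj: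
  assumes "comm_group A" "a \<in> carrier A"
  shows "inv\<^bsub>gen_dihedral A\<^esub> (\<one>\<^bsub>A\<^esub>, 1) \<otimes>\<^bsub>gen_dihedral A\<^esub> (a, 0) \<otimes>\<^bsub>gen_dihedral A\<^esub> (\<one>\<^bsub>A\<^esub>, 1) =
    (inv\<^bsub>A\<^esub> a, 0)"
proof -
  interpret A: comm_group A by fact
  interpret D: group "gen_dihedral A" using assms(1) by (rule group_gen_dihedral)
  have "inv\<^bsub>gen_dihedral A\<^esub> (\<one>\<^bsub>A\<^esub>, 1) = (\<one>\<^bsub>A\<^esub>, 1)"
    by (rule D.inv_equality) (simp_all add: carrier_gen_dihedral mult_gen_dihedral one_gen_dihedral)
  with assms(2) show ?thesis
    by (simp add: mult_gen_dihedral)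
qed

text \<open>
  The underlying abelian group ranges over groups with elements in the type of \<open>G\<close>. By the lemma
  \<open>odd_gen_dihedralI\<close> below this is no restriction: an isomorphism from \<open>G\<close> to the generalized
  dihedral group of an abelian group over any other type gives one of this kind.
\<close>

definition odd_gen_dihedral :: "('a, 'b) monoid_scheme \<Rightarrow> bool" where
  "odd_gen_dihedral G \<longleftrightarrow>
     (\<exists>(A :: 'a monoid) m. comm_group A \<and> finite (carrier A) \<and>
        order (gen_dihedral A) = 2 * m \<and> odd m \<and> G \<cong> gen_dihedral A)"

lemma odd_gen_dihedralI:
  fixes G :: "('a, 'b) monoid_scheme" and A :: "('c, 'm) monoid_scheme"
  assumes G: "group G" and A: "comm_group A" "finite (carrier A)"
    and m: "order (gen_dihedral A) = 2 * m" "odd m" and iso: "G \<cong> gen_dihedral A"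
  shows "odd_gen_dihedral G"
proof -
  interpret A: comm_group A by fact
  interpret D: group "gen_dihedral A" using A(1) by (rule group_gen_dihedral)
  have "gen_dihedral A \<cong> G" using group.iso_sym[OF G iso] .
  then obtain f where f: "f \<in> iso (gen_dihedral A) G" by (auto simp: is_iso_def)
  define g where "g a = f (a, 0)" for a
  define B :: "'a monoid" where
    "B = \<lparr> carrier = g ` carrier A,
           monoid.mult = (\<lambda>x y. x \<otimes>\<^bsub>G\<^esub> y), one = g \<one>\<^bsub>A\<^esub> \<rparr>"
  have inj: "inj_on g (carrier A)"
    using f by (auto simp: iso_def bij_betw_def inj_on_def g_def carrier_gen_dihedral)
  have hom: "g (a \<otimes>\<^bsub>A\<^esub> b) = g a \<otimes>\<^bsub>G\<^esub> g b" if "a \<in> carrier A" "b \<in> carrier A" for a b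
  proof -
    have "f ((a, 0) \<otimes>\<^bsub>gen_dihedral A\<^esub> (b, 0)) = f (a, 0) \<otimes>\<^bsub>G\<^esub> f (b, 0)"
      using f that by (intro hom_mult[of f]) (auto simp: iso_def carrier_gen_dihedral)
    then show ?thesis by (simp add: g_def mult_gen_dihedral)
  qed
  have giso: "g \<in> iso A B"
    using inj hom by (auto simp: iso_def hom_def bij_betw_def B_def)
  have B: "comm_group B"
    using A.iso_imp_img_comm_group[OF giso] by (simp add: B_def)
  have gh: "group_hom A B g"
    using giso A.is_group comm_group.axioms(2)[OF B]
    by (simp add: group_hom_def group_hom_axioms_def iso_def)
  have ginv: "g (inv\<^bsub>A\<^esub> a) = inv\<^bsub>B\<^esub> g a" if "a \<in> carrier A" for a
    using group_hom.hom_inv[OF gh that] .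
  have gmult: "g (a \<otimes>\<^bsub>A\<^esub> b) = g a \<otimes>\<^bsub>B\<^esub> g b" if "a \<in> carrier A" "b \<in> carrier A" for a b
    using hom that by (simp add: B_def)
  have gB: "g a \<in> carrier B" if "a \<in> carrier A" for a
    using that by (simp add: B_def)
  have "(\<lambda>(a, k). (g a, k)) \<in> hom (gen_dihedral A) (gen_dihedral B)"
    by (rule homI) (auto simp: carrier_gen_dihedral mult_gen_dihedral gB ginv gmult)
  moreover have "bij_betw (\<lambda>(a, k). (g a, k))
      (carrier (gen_dihedral A)) (carrier (gen_dihedral B))"
    using inj by (auto simp: bij_betw_def inj_on_def carrier_gen_dihedral B_def image_iff)
  ultimately have AB: "gen_dihedral A \<cong> gen_dihedral B"
    by (auto simp: is_iso_def iso_def)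
  have "order (gen_dihedral B) = 2 * m"
    using m(1) iso_same_card[OF AB] by (simp add: order_def)
  moreover have "finite (carrier B)"
    using A(2) by (simp add: B_def)
  ultimately show ?thesis
    unfolding odd_gen_dihedral_def using B m(2) iso_trans[OF iso AB] by blast
qed

definition cyclic_subgroup :: "'a set \<Rightarrow> ('a, 'b) monoid_scheme \<Rightarrow> bool" where
  "cyclic_subgroup C G \<longleftrightarrow> subgroup C G \<and> cyclic_group (G\<lparr>carrier := C\<rparr>)"

definition maximal_cyclic_subgroups :: "('a, 'b) monoid_scheme \<Rightarrow> 'a set set" where
  "maximal_cyclic_subgroups G =
     {C. cyclic_subgroup C G \<and> (\<forall>C'. cyclic_subgroup C' G \<longrightarrow> \<not> C \<subset> C')}"

end

theory Submission
  imports Defs "HOL-Algebra.Sylow" "HOL-Algebra.Multiplicative_Group"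
begin

text \<open>
  In a finite graph a total dominating set exists exactly when no vertex is isolated, for then all
  vertices together form one. So the equivalence is the classification of the groups with a
  non-central element \<open>x\<close> that commutes with no other non-central element. Multiplying such an \<open>x\<close>
  by central elements, and inverting it, gives non-central elements of its centralizer; so
  \<open>Z(G) = 1\<close>, \<open>x\<^sup>2 = 1\<close> and \<open>C(x) = {1, x}\<close> (\<open>self_centralizing_iff_isolated\<close>).

  If \<open>C(x) = {1, x}\<close> then the conjugacy class \<open>X\<close> of \<open>x\<close> contains half of the group. For \<open>y\<close> in
  \<open>X\<close>, a product \<open>y z\<close> of two elements of \<open>X\<close> is never in \<open>X\<close>: otherwise it would be an involution
  like its factors, so \<open>z\<close> would commute with \<open>y\<close>, and \<open>y z\<close> would be \<open>1\<close>. By counting,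
  \<open>y X = G - X\<close> for \<^emph>\<open>every\<close> \<open>y\<close> in \<open>X\<close>. This freedom in \<open>y\<close> makes \<open>A = G - X\<close> closed under
  multiplication, \<open>(x y)(y z) = x z\<close>, and shows that \<open>x\<close> inverts it, \<open>x (x y) x = y x\<close>. A group on
  which inversion is a homomorphism is abelian, and it has odd order because \<open>x\<close> would commute with
  an involution of \<open>A\<close>. Hence \<open>G\<close> is \<open>D(A)\<close> (\<open>odd_gen_dihedral_if_self_centralizing\<close>). In the opposite direction, \<open>C(x) = {1, x}\<close> is read
  off from the multiplication of \<open>D(A)\<close> when \<open>A\<close> has no involution.

  For the bound, choose a generator of each maximal cyclic subgroup that is not central, and a
  neighbour of each chosen generator. Every vertex lies in one of these subgroups, so it is adjacent
  to the generator or equal to it, and in the latter case adjacent to the chosen neighbour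
  (\<open>total_domination_number_le_maximal_cyclic\<close>).
\<close>

section \<open>Total domination and isolated vertices\<close>

lemma pverts_proper_commuting_graph:
  "pverts (proper_commuting_graph G) = carrier G - group_center G"
  by (simp add: proper_commuting_graph_def)

lemma adjacent_proper_commuting_graph:
  "x \<rightarrow>\<^bsub>proper_commuting_graph G\<^esub> y \<longleftrightarrow>
     x \<in> carrier G - group_center G \<and> y \<in> carrier G - group_center G \<and> x \<noteq> y \<and>
     x \<otimes>\<^bsub>G\<^esub> y = y \<otimes>\<^bsub>G\<^esub> x"
  by (auto simp: proper_commuting_graph_def arcs_ends_conv)

lemma total_dominating_set_exists_iff:
  assumes "pair_graph \<Gamma>"
  shows "(\<exists>S. total_dominating_set \<Gamma> S) \<longleftrightarrow> (\<forall>v \<in> pverts \<Gamma>. \<exists>u. v \<rightarrow>\<^bsub>\<Gamma>\<^esub> u)"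
proof
  interpret pair_graph \<Gamma> by fact
  assume "\<forall>v \<in> pverts \<Gamma>. \<exists>u. v \<rightarrow>\<^bsub>\<Gamma>\<^esub> u"
  then have "total_dominating_set \<Gamma> (pverts \<Gamma>)"
    unfolding total_dominating_set_def using adj_in_verts(2) by fastforce
  then show "\<exists>S. total_dominating_set \<Gamma> S" ..
qed (auto simp: total_dominating_set_def)

lemma total_domination_number_le:
  assumes "total_dominating_set \<Gamma> S" "finite S"
  shows "total_domination_number \<Gamma> \<le> card S"
  unfolding total_domination_number_def using assms by (intro Least_le) blast

section \<open>Self-centralizing involutions\<close>

text \<open>
  The requirement \<open>x \<noteq> 1\<close> turns \<open>C(x) = {1, x}\<close> into a centralizer of order two, so that \<open>x\<close> is
  an involution whose conjugacy class contains half of the group.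
\<close>

definition self_centralizing :: "('a, 'b) monoid_scheme \<Rightarrow> 'a \<Rightarrow> bool" where
  "self_centralizing G x \<longleftrightarrow> x \<in> carrier G \<and> x \<noteq> \<one>\<^bsub>G\<^esub> \<and>
     (\<forall>y \<in> carrier G. x \<otimes>\<^bsub>G\<^esub> y = y \<otimes>\<^bsub>G\<^esub> x \<longrightarrow> y = \<one>\<^bsub>G\<^esub> \<or> y = x)"

context group
begin

lemma self_centralizing_square:
  assumes "self_centralizing G x"
  shows "x \<otimes> x = \<one>"
proof -
  have x: "x \<in> carrier G" "x \<noteq> \<one>"
    and c: "\<And>y. y \<in> carrier G \<Longrightarrow> x \<otimes> y = y \<otimes> x \<Longrightarrow> y = \<one> \<or> y = x"
    using assms by (auto simp: self_centralizing_def)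
  have "inv x = \<one> \<or> inv x = x"
    using x by (intro c) auto
  then show ?thesis
    using x by (metis inv_eq_1_iff r_inv)
qed

lemma self_centralizing_conjugate:
  assumes x: "self_centralizing G x" and g: "g \<in> carrier G"
  shows "self_centralizing G (g \<otimes> x \<otimes> inv g)"
proof -
  have xG: "x \<in> carrier G" and ne: "x \<noteq> \<one>"
    and c: "\<And>y. y \<in> carrier G \<Longrightarrow> x \<otimes> y = y \<otimes> x \<Longrightarrow> y = \<one> \<or> y = x"
    using x by (auto simp: self_centralizing_def)
  have cancel: "g \<otimes> (inv g \<otimes> z) = z" "inv g \<otimes> (g \<otimes> z) = z" if "z \<in> carrier G" for z
    using that g by (simp_all add: m_assoc[symmetric])
  show ?thesis
    unfolding self_centralizing_def
  proof (intro conjI ballI impI)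
    show "g \<otimes> x \<otimes> inv g \<in> carrier G" using g xG by simp
    show "g \<otimes> x \<otimes> inv g \<noteq> \<one>"
    proof
      assume "g \<otimes> x \<otimes> inv g = \<one>"
      then have "inv g \<otimes> (g \<otimes> x \<otimes> inv g) \<otimes> g = inv g \<otimes> \<one> \<otimes> g" by simp
      with g xG ne show False by (simp add: m_assoc cancel)
    qed
  next
    fix y assume y: "y \<in> carrier G"
      and comm: "g \<otimes> x \<otimes> inv g \<otimes> y = y \<otimes> (g \<otimes> x \<otimes> inv g)"
    have "inv g \<otimes> (g \<otimes> x \<otimes> inv g \<otimes> y) \<otimes> g = inv g \<otimes> (y \<otimes> (g \<otimes> x \<otimes> inv g)) \<otimes> g"
      using comm by simp
    then have "x \<otimes> (inv g \<otimes> y \<otimes> g) = (inv g \<otimes> y \<otimes> g) \<otimes> x"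
      using g xG y by (simp add: m_assoc cancel)
    then have "inv g \<otimes> y \<otimes> g = \<one> \<or> inv g \<otimes> y \<otimes> g = x"
      using g y by (intro c) auto
    moreover have "y = g \<otimes> (inv g \<otimes> y \<otimes> g) \<otimes> inv g"
      using g y by (simp add: m_assoc cancel)
    ultimately show "y = \<one> \<or> y = g \<otimes> x \<otimes> inv g"
      using g by auto
  qed
qed

text \<open>
  Two involutions whose product is an involution commute. For \<open>y\<close> and \<open>z\<close> this would mean
  \<open>z = y\<close>, and the product would be \<open>1\<close>. This lemma keeps the translate \<open>y X\<close> of the conjugacy class
  \<open>X\<close> disjoint from \<open>X\<close>.
\<close>

lemma self_centralizing_mult:
  assumes y: "self_centralizing G y" and z: "self_centralizing G z"
  shows "\<not> self_centralizing G (y \<otimes> z)"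
proof
  assume yz: "self_centralizing G (y \<otimes> z)"
  have G: "y \<in> carrier G" "z \<in> carrier G"
    using y z by (auto simp: self_centralizing_def)
  have sq: "y \<otimes> y = \<one>" "z \<otimes> z = \<one>" "(y \<otimes> z) \<otimes> (y \<otimes> z) = \<one>"
    using self_centralizing_square y z yz by auto
  have "inv (y \<otimes> z) = y \<otimes> z" "inv y = y" "inv z = z"
    using sq G by (auto intro: inv_equality)
  then have "y \<otimes> z = z \<otimes> y"
    using G by (metis inv_mult_group)
  then have "z = \<one> \<or> z = y"
    using y G by (auto simp: self_centralizing_def)
  then show False
    using yz z sq(1) by (auto simp: self_centralizing_def)
qed

text \<open>
  The fibres of \<open>g \<mapsto> g x g\<inverse>\<close> are the cosets of \<open>C(x)\<close>, which have two elements.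
\<close>

lemma order_eq_twice_conjugacy_class:
  assumes fin: "finite (carrier G)" and x: "self_centralizing G x"
  shows "order G = 2 * card ((\<lambda>g. g \<otimes> x \<otimes> inv g) ` carrier G)"
proof -
  let ?k = "\<lambda>g. g \<otimes> x \<otimes> inv g"
  have xG: "x \<in> carrier G" and ne: "x \<noteq> \<one>"
    and c: "\<And>y. y \<in> carrier G \<Longrightarrow> x \<otimes> y = y \<otimes> x \<Longrightarrow> y = \<one> \<or> y = x"
    using x by (auto simp: self_centralizing_def)
  have fibre: "card {h \<in> carrier G. ?k h = y} = 2" if y: "y \<in> ?k ` carrier G" for y
  proof -
    obtain g where g: "g \<in> carrier G" "y = ?k g" using y by auto
    have cancel: "g \<otimes> (inv g \<otimes> z) = z" "inv g \<otimes> (g \<otimes> z) = z" if "z \<in> carrier G" for z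
      using that g by (simp_all add: m_assoc[symmetric])
    have "h = g \<or> h = g \<otimes> x" if h: "h \<in> carrier G" "?k h = ?k g" for h
    proof -
      have "inv g \<otimes> (?k h) \<otimes> h = inv g \<otimes> (?k g) \<otimes> h"
        using h by simp
      then have "x \<otimes> (inv g \<otimes> h) = (inv g \<otimes> h) \<otimes> x"
        using g(1) h(1) xG by (simp add: m_assoc cancel)
      then have "inv g \<otimes> h = \<one> \<or> inv g \<otimes> h = x"
        using g h by (intro c) auto
      moreover have "h = g \<otimes> (inv g \<otimes> h)"
        using g h by (simp add: cancel)
      ultimately show ?thesis using g by auto
    qed
    moreover have "?k (g \<otimes> x) = ?k g"
    proof -
      have "x \<otimes> (inv x \<otimes> inv g) = inv g"
        using g xG by (simp add: m_assoc[symmetric])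
      then show ?thesis
        using g xG by (simp add: m_assoc inv_mult_group)
    qed
    ultimately have "{h \<in> carrier G. ?k h = y} = {g, g \<otimes> x}"
      using g xG by auto
    moreover have "g \<otimes> x \<noteq> g"
      using g xG ne by simp
    ultimately show ?thesis by simp
  qed
  have "order G = (\<Sum>h\<in>carrier G. 1)"
    by (simp add: order_def)
  also have "\<dots> = (\<Sum>y\<in>?k ` carrier G. \<Sum>h\<in>{h \<in> carrier G. ?k h = y}. 1)"
    by (rule sum.image_gen[OF fin])
  also have "\<dots> = (\<Sum>y\<in>?k ` carrier G. 2)"
    using fibre by (intro sum.cong) auto
  finally show ?thesis by simp
qed

lemma odd_order_if_no_involution:
  assumes "finite (carrier G)" and "\<And>a. a \<in> carrier G \<Longrightarrow> a \<otimes> a = \<one> \<Longrightarrow> a = \<one>"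
  shows "odd (order G)"
proof
  assume "even (order G)"
  then obtain m where "order G = 2 ^ 1 * m" by auto
  then obtain H where H: "subgroup H G" "card H = 2"
    using sylow_thm[OF two_is_prime_nat is_group _ assms(1), of 1 m] by auto
  then obtain a where a: "H = {\<one>, a}" "a \<noteq> \<one>"
    using subgroup.one_closed[OF H(1)] by (auto simp: card_2_iff)
  have aG: "a \<in> carrier G"
    using a(1) subgroup.subset[OF H(1)] by simp
  have "a \<otimes> a \<in> {\<one>, a}"
    using subgroup.m_closed[OF H(1), of a a] a(1) by simp
  then have "a \<otimes> a = \<one>"
    using a(2) aG by simp
  then show False
    using assms(2)[OF aG] a(2) by simp
qed

lemma no_involution_if_odd_order:
  assumes "odd (order G)" and a: "a \<in> carrier G" "a \<otimes> a = \<one>"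
  shows "a = \<one>"
proof -
  obtain j where j: "order G = Suc (2 * j)"
    using assms(1) by (auto elim: oddE)
  have "(a [^] (2::nat)) [^] j = a [^] (2 * j)"
    using a by (simp add: nat_pow_pow)
  moreover have "a [^] (2::nat) = \<one>"
    using a by (simp add: numeral_2_eq_2)
  moreover have "a [^] order G = \<one>"
    using a pow_order_eq_1 by simp
  ultimately show ?thesis
    using a j by simp
qed

text \<open>
  The internal form of \<open>D(A)\<close>: the pair \<open>(a, k)\<close> corresponds to \<open>a x\<^sup>k\<close>, and the twisted product of
  pairs is the rule for moving \<open>x\<close> past an element of \<open>A\<close>.
\<close>

lemma iso_gen_dihedral_of_inverting_involution:
  assumes A: "subgroup A G" "comm_group (G\<lparr>carrier := A\<rparr>)"
    and x: "x \<in> carrier G" "x \<notin> A" "x \<otimes> x = \<one>"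
    and inverts: "\<And>a. a \<in> A \<Longrightarrow> x \<otimes> a = inv a \<otimes> x"
    and index: "carrier G = A \<union> (\<lambda>a. a \<otimes> x) ` A"
  shows "G \<cong> gen_dihedral (G\<lparr>carrier := A\<rparr>)"
proof -
  let ?A = "G\<lparr>carrier := A\<rparr>"
  let ?f = "\<lambda>(a, k::int). if k = 0 then a else a \<otimes> x"
  interpret D: group "gen_dihedral ?A" by (rule group_gen_dihedral[OF A(2)])
  have AG: "a \<in> carrier G" if "a \<in> A" for a
    using that A(1) by (rule subgroup.mem_carrier[rotated])
  have invA: "inv\<^bsub>?A\<^esub> a = inv a" if "a \<in> A" for a
    using that m_inv_consistent[OF A(1)] by simp
  have swap: "a \<otimes> x \<otimes> b = a \<otimes> inv b \<otimes> x" if "a \<in> A" "b \<in> A" for a b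
    using inverts[OF that(2)] AG[OF that(1)] AG[OF that(2)] x(1) by (simp add: m_assoc)
  have swap_x: "a \<otimes> x \<otimes> (b \<otimes> x) = a \<otimes> inv b" if "a \<in> A" "b \<in> A" for a b
  proof -
    note G = AG[OF that(1)] AG[OF that(2)] x(1)
    have "a \<otimes> x \<otimes> (b \<otimes> x) = a \<otimes> x \<otimes> b \<otimes> x"
      using G by (simp add: m_assoc)
    also have "\<dots> = a \<otimes> inv b \<otimes> (x \<otimes> x)"
      unfolding swap[OF that] using G by (simp add: m_assoc)
    finally show ?thesis using G x(3) by simp
  qed
  have "?f p \<otimes> ?f q = ?f (p \<otimes>\<^bsub>gen_dihedral ?A\<^esub> q)"
    if p: "p \<in> A \<times> {0, 1}" and q: "q \<in> A \<times> {0, 1}" for p q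
  proof -
    obtain a k where a: "p = (a, k)" "a \<in> A" "k = 0 \<or> k = 1"
      using p by auto
    obtain b l where b: "q = (b, l)" "b \<in> A" "l = 0 \<or> l = 1"
      using q by auto
    show ?thesis
      using a(3) b(3) swap[OF a(2) b(2)] swap_x[OF a(2) b(2)] AG[OF a(2)] AG[OF b(2)] x(1)
      unfolding a(1) b(1) mult_gen_dihedral invA[OF b(2)]
      by (elim disjE) (simp_all add: m_assoc)
  qed
  then have "?f \<in> hom (gen_dihedral ?A) G"
    using AG x by (intro homI) (auto simp: carrier_gen_dihedral)
  moreover have "bij_betw ?f (carrier (gen_dihedral ?A)) (carrier G)"
  proof -
    have ax: "a \<otimes> x \<notin> A" if a: "a \<in> A" for a
    proof
      assume "a \<otimes> x \<in> A"
      then have "inv a \<otimes> (a \<otimes> x) \<in> A"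
        using a A(1) by (simp add: subgroup.m_closed subgroup.m_inv_closed)
      with a x AG show False by (simp add: m_assoc[symmetric])
    qed
    have "inj_on ?f (carrier (gen_dihedral ?A))"
    proof (rule inj_onI)
      fix p q
      assume p: "p \<in> carrier (gen_dihedral ?A)" and q: "q \<in> carrier (gen_dihedral ?A)"
        and eq: "?f p = ?f q"
      obtain a k where a: "p = (a, k)" "a \<in> A" "k = 0 \<or> k = 1"
        using p by (auto simp: carrier_gen_dihedral)
      obtain b l where b: "q = (b, l)" "b \<in> A" "l = 0 \<or> l = 1"
        using q by (auto simp: carrier_gen_dihedral)
      show "p = q"
        using eq a(3) b(3) ax[OF a(2)] ax[OF b(2)] a(2) b(2) AG[OF a(2)] AG[OF b(2)] x(1)
        unfolding a(1) b(1) by (elim disjE) auto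
    qed
    moreover have "?f ` (A \<times> {0, 1}) = carrier G"
    proof -
      have "?f ` (A \<times> {0, 1}) = ?f ` (\<lambda>a. (a, 0)) ` A \<union> ?f ` (\<lambda>a. (a, 1)) ` A"
        by blast
      also have "\<dots> = carrier G"
        unfolding index by (simp add: image_image)
      finally show ?thesis .
    qed
    ultimately show ?thesis by (simp add: bij_betw_def carrier_gen_dihedral)
  qed
  ultimately have "gen_dihedral ?A \<cong> G"
    by (auto simp: is_iso_def iso_def)
  then show ?thesis by (rule D.iso_sym)
qed

text \<open>
  The subgroup \<open>A\<close> is obtained as the complement of the conjugacy class \<open>X\<close> of \<open>x\<close>, and by
  counting it equals \<open>y X\<close> for each \<open>y\<close> in \<open>X\<close>. An element of \<open>A\<close> can therefore be written as
  \<open>y z\<close> with a first factor \<open>y\<close> prescribed in \<open>X\<close>, and such factors cancel since they are involutions.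
\<close>

lemma odd_gen_dihedral_if_self_centralizing:
  assumes fin: "finite (carrier G)" and x: "self_centralizing G x"
  shows "odd_gen_dihedral G"
proof -
  define X where "X = (\<lambda>g. g \<otimes> x \<otimes> inv g) ` carrier G"
  define A where "A = carrier G - X"
  have xG: "x \<in> carrier G"
    and c: "\<And>y. y \<in> carrier G \<Longrightarrow> x \<otimes> y = y \<otimes> x \<Longrightarrow> y = \<one> \<or> y = x"
    using x by (auto simp: self_centralizing_def)
  have X: "self_centralizing G y" if "y \<in> X" for y
    using that self_centralizing_conjugate[OF x] by (auto simp: X_def)
  have XG: "X \<subseteq> carrier G"
    using xG by (auto simp: X_def)
  have sq: "y \<otimes> y = \<one>" if "y \<in> X" for y
    using X[OF that] by (rule self_centralizing_square)
  have xX: "x \<in> X"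
    unfolding X_def using xG by (intro image_eqI[of _ _ \<one>]) auto
  have cancel: "y \<otimes> (y \<otimes> z) = z" if "y \<in> X" "z \<in> carrier G" for y z
    using sq[OF that(1)] that XG by (simp add: m_assoc[symmetric] subset_iff)
  have "card (carrier G) = 2 * card X"
    using order_eq_twice_conjugacy_class[OF fin x] by (simp add: order_def X_def)
  then have cardA: "card A = card X"
    using XG fin by (simp add: A_def card_Diff_subset finite_subset)
  have translate: "(\<lambda>z. y \<otimes> z) ` X = A" if y: "y \<in> X" for y
  proof (rule card_subset_eq)
    show "finite A" using fin by (simp add: A_def)
    show "(\<lambda>z. y \<otimes> z) ` X \<subseteq> A"
      using self_centralizing_mult X y XG by (auto simp: A_def)
    have "inj_on (\<lambda>z. y \<otimes> z) X"
      using XG y by (intro inj_on_subset[OF inj_on_cmult]) auto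
    then show "card ((\<lambda>z. y \<otimes> z) ` X) = card A"
      by (simp add: card_image cardA)
  qed
  have inverse: "inv (x \<otimes> y) = y \<otimes> x" if "y \<in> X" for y
    using that xX XG cancel[OF that] sq xG by (intro inv_equality) (auto simp: m_assoc cancel)
  have conj: "x \<otimes> a = inv a \<otimes> x" "inv a \<in> A" if "a \<in> A" for a
  proof -
    obtain y where y: "y \<in> X" "a = x \<otimes> y" using \<open>a \<in> A\<close> translate[OF xX] by auto
    then show "x \<otimes> a = inv a \<otimes> x"
      using inverse xX XG xG sq by (simp add: cancel m_assoc subset_iff)
    have "y \<otimes> x \<in> A" using translate[OF y(1)] xX by auto
    then show "inv a \<in> A" using y inverse by simp
  qed
  have closed: "a \<otimes> b \<in> A" if "a \<in> A" "b \<in> A" for a b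
  proof -
    obtain y where y: "y \<in> X" "a = x \<otimes> y" using \<open>a \<in> A\<close> translate[OF xX] by auto
    obtain z where z: "z \<in> X" "b = y \<otimes> z" using \<open>b \<in> A\<close> translate[OF y(1)] by auto
    have "a \<otimes> b = x \<otimes> z"
      using y z XG xG by (simp add: m_assoc cancel subset_iff)
    then show ?thesis using translate[OF xX] z(1) by auto
  qed
  have "A \<noteq> {}" using translate[OF xX] xX by auto
  then have sub: "subgroup A G"
    using closed conj(2) by (intro subgroupI) (auto simp: A_def)
  interpret A: group "G\<lparr>carrier := A\<rparr>"
    using sub by (rule subgroup_imp_group)
  have AG: "a \<in> carrier G" if "a \<in> A" for a
    using that by (simp add: A_def)
  \<comment> \<open>Moving \<open>x\<close> past both factors inverts them one by one, moving it past the product inverts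
    the product: so \<open>(b a)\<inverse> x\<close> is \<open>x (a b)\<close> and also \<open>x (b a)\<close>.\<close>
  have "a \<otimes> b = b \<otimes> a" if ab: "a \<in> A" "b \<in> A" for a b
  proof -
    have "x \<otimes> (a \<otimes> b) = inv a \<otimes> (x \<otimes> b)"
      using conj(1)[OF ab(1)] ab AG xG by (simp add: m_assoc[symmetric])
    also have "\<dots> = inv (b \<otimes> a) \<otimes> x"
      using conj(1)[OF ab(2)] ab AG xG by (simp add: m_assoc inv_mult_group)
    also have "\<dots> = x \<otimes> (b \<otimes> a)"
      using conj(1)[OF closed[OF ab(2,1)]] by simp
    finally show ?thesis using ab AG xG by simp
  qed
  then have comm: "comm_group (G\<lparr>carrier := A\<rparr>)"
    by (intro A.group_comm_groupI) auto
  have "G \<cong> gen_dihedral (G\<lparr>carrier := A\<rparr>)"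
  proof (rule iso_gen_dihedral_of_inverting_involution[OF sub comm xG _ sq[OF xX] conj(1)])
    show "x \<notin> A" using xX by (simp add: A_def)
    have "y \<in> (\<lambda>a. a \<otimes> x) ` A" if y: "y \<in> X" for y
    proof (rule image_eqI)
      show "y \<otimes> x \<in> A" using translate[OF y] xX by auto
      show "y = y \<otimes> x \<otimes> x" using y XG xG sq[OF xX] by (simp add: m_assoc subset_iff)
    qed
    then show "carrier G = A \<union> (\<lambda>a. a \<otimes> x) ` A"
      using AG xG by (auto simp: A_def)
  qed
  moreover have "odd (card A)"
  proof -
    have "a = \<one>" if a: "a \<in> A" "a \<otimes> a = \<one>" for a
    proof -
      have "inv a = a" using a AG by (intro inv_equality) auto
      then have "a = \<one> \<or> a = x"
        using conj(1)[OF a(1)] a AG by (intro c) auto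
      then show ?thesis using a xX by (auto simp: A_def)
    qed
    then show ?thesis
      using A.odd_order_if_no_involution fin by (auto simp: order_def A_def)
  qed
  moreover have "order (gen_dihedral (G\<lparr>carrier := A\<rparr>)) = 2 * card A"
    by (simp add: order_def carrier_gen_dihedral card_cartesian_product)
  ultimately show ?thesis
    using comm fin by (intro odd_gen_dihedralI[OF is_group comm]) (auto simp: A_def)
qed

end

text \<open>
  Since \<open>(1,1)(a,0) = (a\<inverse>,1)\<close> and \<open>(1,1)(a,1) = (a\<inverse>,0)\<close>, an element that commutes with \<open>(1,1)\<close>
  has a first component with \<open>a = a\<inverse>\<close>.
\<close>

lemma self_centralizing_gen_dihedral:
  assumes A: "comm_group A" and odd: "odd (order A)"
  shows "self_centralizing (gen_dihedral A) (\<one>\<^bsub>A\<^esub>, 1)"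
proof -
  interpret A: comm_group A by fact
  have no_involution: "a = \<one>\<^bsub>A\<^esub>" if a: "a \<in> carrier A" "a = inv\<^bsub>A\<^esub> a" for a
  proof (rule A.no_involution_if_odd_order[OF odd a(1)])
    show "a \<otimes>\<^bsub>A\<^esub> a = \<one>\<^bsub>A\<^esub>"
      using A.r_inv[OF a(1)] by (subst (2) a(2))
  qed
  show ?thesis
    unfolding self_centralizing_def
  proof (intro conjI ballI impI)
    fix y
    assume y: "y \<in> carrier (gen_dihedral A)"
      and comm: "(\<one>\<^bsub>A\<^esub>, 1) \<otimes>\<^bsub>gen_dihedral A\<^esub> y = y \<otimes>\<^bsub>gen_dihedral A\<^esub> (\<one>\<^bsub>A\<^esub>, 1)"
    obtain a k where ak: "y = (a, k)" "a \<in> carrier A" "k = 0 \<or> k = 1"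
      using y by (auto simp: carrier_gen_dihedral)
    have "inv\<^bsub>A\<^esub> a = a"
      using comm ak(3) A.inv_closed[OF ak(2)] ak(2) unfolding ak(1) mult_gen_dihedral
      by (elim disjE) simp_all
    then have "a = \<one>\<^bsub>A\<^esub>"
      by (intro no_involution ak(2)) simp
    then show "y = \<one>\<^bsub>gen_dihedral A\<^esub> \<or> y = (\<one>\<^bsub>A\<^esub>, 1)"
      using ak by (auto simp: one_gen_dihedral)
  qed (auto simp: carrier_gen_dihedral one_gen_dihedral)
qed

lemma self_centralizing_iso:
  assumes f: "f \<in> iso G H" and "group G" "group H" and x: "self_centralizing G x"
  shows "self_centralizing H (f x)"
proof -
  interpret group_hom G H f
    using assms by (simp add: group_hom_def group_hom_axioms_def iso_def)
  have bij: "inj_on f (carrier G)" "f ` carrier G = carrier H"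
    using f by (auto simp: iso_def bij_betw_def)
  have xG: "x \<in> carrier G" "x \<noteq> \<one>\<^bsub>G\<^esub>"
    and c: "\<And>y. y \<in> carrier G \<Longrightarrow> x \<otimes>\<^bsub>G\<^esub> y = y \<otimes>\<^bsub>G\<^esub> x \<Longrightarrow> y = \<one>\<^bsub>G\<^esub> \<or> y = x"
    using x by (auto simp: self_centralizing_def)
  show ?thesis
    unfolding self_centralizing_def
  proof (intro conjI ballI impI)
    show "f x \<in> carrier H" using xG by simp
    show "f x \<noteq> \<one>\<^bsub>H\<^esub>" using xG bij(1) by (metis G.one_closed hom_one inj_onD)
  next
    fix y assume y: "y \<in> carrier H" "f x \<otimes>\<^bsub>H\<^esub> y = y \<otimes>\<^bsub>H\<^esub> f x"
    then obtain z where z: "z \<in> carrier G" "y = f z" using bij(2) by auto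
    with y xG have "f (x \<otimes>\<^bsub>G\<^esub> z) = f (z \<otimes>\<^bsub>G\<^esub> x)" by simp
    then have "x \<otimes>\<^bsub>G\<^esub> z = z \<otimes>\<^bsub>G\<^esub> x"
      using xG(1) z(1) by (intro inj_onD[OF bij(1)]) auto
    then show "y = \<one>\<^bsub>H\<^esub> \<or> y = f x" using c[OF z(1)] z(2) hom_one by blast
  qed
qed

lemma odd_gen_dihedral_iff_self_centralizing:
  assumes G: "group G" "finite (carrier G)"
  shows "odd_gen_dihedral G \<longleftrightarrow> (\<exists>x. self_centralizing G x)"
proof
  assume "odd_gen_dihedral G"
  then obtain A :: "'a monoid" and m where A: "comm_group A" "finite (carrier A)"
    and m: "order (gen_dihedral A) = 2 * m" "odd m" and iso: "G \<cong> gen_dihedral A"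
    by (auto simp: odd_gen_dihedral_def)
  have "order A = m"
    using m(1) by (simp add: order_def carrier_gen_dihedral card_cartesian_product)
  then have x: "self_centralizing (gen_dihedral A) (\<one>\<^bsub>A\<^esub>, 1)"
    using m(2) by (intro self_centralizing_gen_dihedral A) simp
  obtain f where "f \<in> iso (gen_dihedral A) G"
    using group.iso_sym[OF G(1) iso] by (auto simp: is_iso_def)
  then show "\<exists>x. self_centralizing G x"
    using self_centralizing_iso[OF _ group_gen_dihedral[OF A(1)] G(1) x] by blast
next
  assume "\<exists>x. self_centralizing G x"
  then show "odd_gen_dihedral G"
    using group.odd_gen_dihedral_if_self_centralizing[OF G] by blast
qed

section \<open>Isolated vertices of the proper commuting graph\<close>

context group
begin

text \<open>
  If \<open>x\<close> is isolated then \<open>z x\<close>, for \<open>z\<close> central, is a vertex that commutes with \<open>x\<close>. Hence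
  \<open>z x = x\<close>: the center is trivial, and its identity is the only element besides \<open>x\<close> in the
  centralizer of \<open>x\<close>. Conversely, a central \<open>x\<close> with \<open>C(x) = {1, x}\<close> leaves only two elements in
  the group, and a group of order two is abelian.
\<close>

lemma self_centralizing_iff_isolated:
  assumes "\<not> comm_group G"
  shows "self_centralizing G x \<longleftrightarrow>
    x \<in> carrier G - group_center G \<and> \<not> (\<exists>u. x \<rightarrow>\<^bsub>proper_commuting_graph G\<^esub> u)"
proof
  assume x: "self_centralizing G x"
  then have xG: "x \<in> carrier G"
    and c: "\<And>y. y \<in> carrier G \<Longrightarrow> x \<otimes> y = y \<otimes> x \<Longrightarrow> y = \<one> \<or> y = x"
    by (auto simp: self_centralizing_def)
  have "x \<notin> group_center G"
  proof
    assume "x \<in> group_center G"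
    then have "y = \<one> \<or> y = x" if "y \<in> carrier G" for y
      using c that by (auto simp: group_center_def)
    then have "comm_group G"
      by (intro group_comm_groupI) (metis l_one r_one)
    with assms show False by simp
  qed
  moreover have "\<one> \<in> group_center G" by (auto simp: group_center_def)
  ultimately show "x \<in> carrier G - group_center G \<and>
      \<not> (\<exists>u. x \<rightarrow>\<^bsub>proper_commuting_graph G\<^esub> u)"
    unfolding adjacent_proper_commuting_graph using xG c by blast
next
  assume "x \<in> carrier G - group_center G \<and> \<not> (\<exists>u. x \<rightarrow>\<^bsub>proper_commuting_graph G\<^esub> u)"
  then have x: "x \<in> carrier G" "x \<notin> group_center G"
    and isolated: "\<And>y. y \<in> carrier G \<Longrightarrow> y \<notin> group_center G \<Longrightarrow> x \<otimes> y = y \<otimes> x \<Longrightarrow> y = x"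
    unfolding adjacent_proper_commuting_graph by blast+
  have trivial: "z = \<one>" if z: "z \<in> group_center G" for z
  proof -
    have zG: "z \<in> carrier G" and zc: "\<And>g. g \<in> carrier G \<Longrightarrow> z \<otimes> g = g \<otimes> z"
      using z by (auto simp: group_center_def)
    have "z \<otimes> x \<notin> group_center G"
    proof
      assume "z \<otimes> x \<in> group_center G"
      then have comm: "z \<otimes> x \<otimes> g = g \<otimes> (z \<otimes> x)" if "g \<in> carrier G" for g
        using that by (simp add: group_center_def)
      have "x \<otimes> g = g \<otimes> x" if g: "g \<in> carrier G" for g
      proof -
        have "z \<otimes> (x \<otimes> g) = g \<otimes> z \<otimes> x"
          using comm[OF g] zG x(1) g by (simp add: m_assoc)
        also have "\<dots> = z \<otimes> (g \<otimes> x)"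
          unfolding zc[OF g, symmetric] using zG x(1) g by (simp add: m_assoc)
        finally show ?thesis
          using zG x(1) g by (auto intro: inj_onD[OF inj_on_cmult[OF zG]])
      qed
      then have "x \<in> group_center G"
        using x(1) by (simp add: group_center_def)
      with x show False by simp
    qed
    moreover have "x \<otimes> (z \<otimes> x) = (z \<otimes> x) \<otimes> x"
      using zc[of x] x(1) zG m_assoc[of x z x] by simp
    ultimately have "z \<otimes> x = x"
      using x zG by (intro isolated) auto
    then show ?thesis using x zG by simp
  qed
  have one_central: "\<one> \<in> group_center G" by (auto simp: group_center_def)
  show "self_centralizing G x"
    unfolding self_centralizing_def
  proof (intro conjI ballI impI)
    show "x \<noteq> \<one>" using x(2) one_central by auto
  next
    fix y assume "y \<in> carrier G" "x \<otimes> y = y \<otimes> x"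
    then show "y = \<one> \<or> y = x" using trivial isolated by blast
  qed (rule x(1))
qed

section \<open>Maximal cyclic subgroups\<close>

lemma subgroup_group_center: "subgroup (group_center G) G"
proof (rule subgroupI)
  fix a assume "a \<in> group_center G"
  then have a: "a \<in> carrier G" "\<And>g. g \<in> carrier G \<Longrightarrow> a \<otimes> g = g \<otimes> a"
    by (auto simp: group_center_def)
  have "inv a \<otimes> g = g \<otimes> inv a" if g: "g \<in> carrier G" for g
    using a g by (metis inv_closed inv_inv inv_mult_group)
  with a show "inv a \<in> group_center G" by (simp add: group_center_def)
next
  fix a b assume ab: "a \<in> group_center G" "b \<in> group_center G"
  then have G: "a \<in> carrier G" "b \<in> carrier G"
    and c: "\<And>g. g \<in> carrier G \<Longrightarrow> a \<otimes> g = g \<otimes> a" "\<And>g. g \<in> carrier G \<Longrightarrow> b \<otimes> g = g \<otimes> b"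
    by (auto simp: group_center_def)
  have "a \<otimes> b \<otimes> g = g \<otimes> (a \<otimes> b)" if g: "g \<in> carrier G" for g
    using G c g by (metis m_assoc)
  with G show "a \<otimes> b \<in> group_center G" by (simp add: group_center_def)
qed (auto simp: group_center_def)

lemma cyclic_subgroup_generate:
  assumes "v \<in> carrier G"
  shows "cyclic_subgroup (generate G {v}) G"
  using assms generate_is_subgroup[of "{v}"] cyclic_group_generated[of v]
  by (simp add: cyclic_subgroup_def subgroup_generated_def)

lemma cyclic_subgroup_generator:
  assumes "cyclic_subgroup C G"
  obtains c where "c \<in> C" "C = range (\<lambda>n::int. c [^] n)"
proof -
  have C: "subgroup C G" "cyclic_group (G\<lparr>carrier := C\<rparr>)"
    using assms by (auto simp: cyclic_subgroup_def)
  then obtain c where c: "c \<in> C" "C = range (\<lambda>n::int. c [^]\<^bsub>G\<lparr>carrier := C\<rparr>\<^esub> n)"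
    using group.cyclic_group[OF subgroup_imp_group[OF C(1)]] by auto
  moreover have "c [^]\<^bsub>G\<lparr>carrier := C\<rparr>\<^esub> n = c [^] n" for n :: int
    using int_pow_consistent[OF C(1) c(1)] by simp
  ultimately show ?thesis by (intro that) auto
qed

lemma finite_maximal_cyclic_subgroups:
  assumes "finite (carrier G)"
  shows "finite (maximal_cyclic_subgroups G)"
proof (rule finite_subset)
  show "maximal_cyclic_subgroups G \<subseteq> Pow (carrier G)"
    by (auto simp: maximal_cyclic_subgroups_def cyclic_subgroup_def dest: subgroup.mem_carrier)
qed (use assms in simp)

lemma maximal_cyclic_subgroup_containing:
  assumes fin: "finite (carrier G)" and v: "v \<in> carrier G"
  obtains C where "C \<in> maximal_cyclic_subgroups G" "v \<in> C"
proof -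
  let ?\<C> = "{C. cyclic_subgroup C G}"
  have "?\<C> \<subseteq> Pow (carrier G)"
    by (auto simp: cyclic_subgroup_def dest: subgroup.mem_carrier)
  then have "finite ?\<C>" using fin finite_subset by blast
  then obtain C where C: "C \<in> ?\<C>" "generate G {v} \<subseteq> C"
    and max: "\<And>D. D \<in> ?\<C> \<Longrightarrow> C \<subseteq> D \<Longrightarrow> C = D"
    using finite_has_maximal2[of ?\<C> "generate G {v}"] cyclic_subgroup_generate[OF v] by auto
  show ?thesis
  proof
    show "C \<in> maximal_cyclic_subgroups G"
      using C(1) max by (auto simp: maximal_cyclic_subgroups_def)
    show "v \<in> C" using C(2) generate.incl[of v "{v}" G] by auto
  qed
qed

lemma total_domination_number_le_maximal_cyclic:
  assumes fin: "finite (carrier G)"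
    and no_isolated: "\<forall>v \<in> carrier G - group_center G. \<exists>u. v \<rightarrow>\<^bsub>proper_commuting_graph G\<^esub> u"
  shows "total_domination_number (proper_commuting_graph G) \<le>
    2 * card {C \<in> maximal_cyclic_subgroups G. \<not> C \<subseteq> group_center G}"
proof -
  let ?\<Gamma> = "proper_commuting_graph G"
  let ?M = "{C \<in> maximal_cyclic_subgroups G. \<not> C \<subseteq> group_center G}"
  have sub: "subgroup C G" if "C \<in> ?M" for C
    using that by (auto simp: maximal_cyclic_subgroups_def cyclic_subgroup_def)
  have finM: "finite ?M"
    using finite_maximal_cyclic_subgroups[OF fin] by simp
  \<comment> \<open>A generator of a subgroup outside the center is not central, since the center is closed
    under powers.\<close>
  have "\<exists>c. c \<in> carrier G - group_center G \<and> (\<forall>v \<in> C. c \<otimes> v = v \<otimes> c)" if C: "C \<in> ?M" for C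
  proof -
    obtain c where c: "c \<in> C" "C = range (\<lambda>n::int. c [^] n)"
      using C cyclic_subgroup_generator[of C] by (auto simp: maximal_cyclic_subgroups_def)
    have cG: "c \<in> carrier G" using c(1) sub[OF C] by (rule subgroup.mem_carrier[rotated])
    have "c \<notin> group_center G"
    proof
      assume "c \<in> group_center G"
      then have "C \<subseteq> group_center G"
        using subgroup_int_pow_closed[OF subgroup_group_center] c(2) by auto
      with C show False by simp
    qed
    moreover have "c \<otimes> c [^] n = c [^] n \<otimes> c" for n :: int
      using int_pow_mult[OF cG, of 1 n] int_pow_mult[OF cG, of n 1] cG
      by (simp add: add.commute)
    ultimately show ?thesis using c cG by auto
  qed
  then have "\<exists>c. \<forall>C \<in> ?M. c C \<in> carrier G - group_center G \<and> (\<forall>v \<in> C. c C \<otimes> v = v \<otimes> c C)"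
    by (intro bchoice ballI)
  then obtain c where c: "\<And>C. C \<in> ?M \<Longrightarrow> c C \<in> carrier G - group_center G"
    and c_comm: "\<And>C v. C \<in> ?M \<Longrightarrow> v \<in> C \<Longrightarrow> c C \<otimes> v = v \<otimes> c C"
    by blast
  obtain d where d: "\<And>v. v \<in> carrier G - group_center G \<Longrightarrow> v \<rightarrow>\<^bsub>?\<Gamma>\<^esub> d v"
    using bchoice[OF no_isolated] by blast
  define S where "S = c ` ?M \<union> (\<lambda>C. d (c C)) ` ?M"
  have "total_dominating_set ?\<Gamma> S"
    unfolding total_dominating_set_def pverts_proper_commuting_graph
  proof (intro conjI ballI)
    show "S \<subseteq> carrier G - group_center G"
      using c d[OF c] unfolding S_def adjacent_proper_commuting_graph by blast
  next
    fix v assume v: "v \<in> carrier G - group_center G"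
    then obtain C where C: "C \<in> maximal_cyclic_subgroups G" "v \<in> C"
      using maximal_cyclic_subgroup_containing[OF fin] by blast
    then have CM: "C \<in> ?M" using v by auto
    show "\<exists>u \<in> S. v \<rightarrow>\<^bsub>?\<Gamma>\<^esub> u"
    proof (cases "v = c C")
      case True
      have "v \<rightarrow>\<^bsub>?\<Gamma>\<^esub> d (c C)" using d[OF v] unfolding True .
      moreover have "d (c C) \<in> S" using CM unfolding S_def by blast
      ultimately show ?thesis ..
    next
      case False
      have "v \<rightarrow>\<^bsub>?\<Gamma>\<^esub> c C"
        unfolding adjacent_proper_commuting_graph
        using v c[OF CM] c_comm[OF CM C(2)] False by simp
      then show ?thesis using CM unfolding S_def by blast
    qed
  qed
  then have "total_domination_number ?\<Gamma> \<le> card S"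
    using finM by (intro total_domination_number_le) (simp_all add: S_def)
  also have "card S \<le> card (c ` ?M) + card ((\<lambda>C. d (c C)) ` ?M)"
    unfolding S_def by (rule card_Un_le)
  also have "\<dots> \<le> card ?M + card ?M"
    using finM by (intro add_mono card_image_le)
  finally show ?thesis by simp
qed

end

theorem theorem1p5:
  fixes G :: "('a, 'b) monoid_scheme"
  assumes "group G" and "finite (carrier G)" and "\<not> comm_group G"
  shows "((\<exists>S. total_dominating_set (proper_commuting_graph G) S) \<longleftrightarrow> \<not> odd_gen_dihedral G) \<and>
    ((\<exists>S. total_dominating_set (proper_commuting_graph G) S) \<longrightarrow>
       int (total_domination_number (proper_commuting_graph G)) \<le>
         2 * (int (card (maximal_cyclic_subgroups G)) -
              int (card {C \<in> maximal_cyclic_subgroups G. C \<subseteq> group_center G})))"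
proof -
  interpret group G by fact
  let ?\<Gamma> = "proper_commuting_graph G"
  let ?T = "maximal_cyclic_subgroups G"
  let ?U = "{C \<in> ?T. C \<subseteq> group_center G}"
  have exists_iff: "(\<exists>S. total_dominating_set ?\<Gamma> S) \<longleftrightarrow>
      (\<forall>v \<in> carrier G - group_center G. \<exists>u. v \<rightarrow>\<^bsub>?\<Gamma>\<^esub> u)"
    using total_dominating_set_exists_iff[OF pair_graph_proper_commuting_graph[OF assms(2)]]
    by (simp only: pverts_proper_commuting_graph)
  have "odd_gen_dihedral G \<longleftrightarrow>
      (\<exists>v \<in> carrier G - group_center G. \<not> (\<exists>u. v \<rightarrow>\<^bsub>?\<Gamma>\<^esub> u))"
    using odd_gen_dihedral_iff_self_centralizing[OF assms(1,2)]
      self_centralizing_iff_isolated[OF assms(3)] by blast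
  then have "(\<exists>S. total_dominating_set ?\<Gamma> S) \<longleftrightarrow> \<not> odd_gen_dihedral G"
    using exists_iff by blast
  moreover have "int (total_domination_number ?\<Gamma>) \<le> 2 * (int (card ?T) - int (card ?U))"
    if "\<exists>S. total_dominating_set ?\<Gamma> S"
  proof -
    have fin: "finite ?T"
      using assms(2) by (rule finite_maximal_cyclic_subgroups)
    have "{C \<in> ?T. \<not> C \<subseteq> group_center G} = ?T - ?U" by auto
    then have "card {C \<in> ?T. \<not> C \<subseteq> group_center G} = card ?T - card ?U"
      using fin by (simp add: card_Diff_subset)
    moreover have "card ?U \<le> card ?T" using fin by (intro card_mono) auto
    ultimately show ?thesis
      using total_domination_number_le_maximal_cyclic[OF assms(2)] exists_iff that by force
  qed
  ultimately show ?thesis by blast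
qed

end
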